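(* Let $X$ be a Euclidean space and $(E,\|\cdot\|_E)$ a Banach space. For every bounded family $\mathcal{F}\in\mathcal{M}(C^b(X,E))$ define $$\Omega(\mathcal{F}) := \eta(\mathcal{F})+\omega_0(\mathcal{F})+\chi_0(\mathcal{F}),$$ where $\eta,\omega_0,\chi_0$ are the functionals defined in the context. Then $\Omega:\mathcal{M}(C^b(X,E))\to\mathbb{R}_+$ is a quasimeasure of noncompactness on $C^b(X,E)$. Moreover, for every $\mathcal{F}\in\mathcal{M}(C^b(X,E))$, $$\Omega(\mathcal{F})=0 \ \Longrightarrow\ \Omega(\mathrm{conv}(\mathcal{F}))=0 .$$
   Context: $\mathbb{R}_+=[0,\infty)$. Banach spaces are over $\mathbb{R}$ or $\mathbb{C}$. $C^b(X,E)$ is the Banach space of bounded continuous functions $X\to E$ with the supremum norm, and $d_{C^b(X,E)}(f,g)=\sup_{x\in X}\|f(x)-g(x)\|_E$. For compact $D\subset X$, $d_{C(D,E)}(f,g)=\sup_{x\in D}\|f(x)-g(x)\|_E$. For a Banach space $Y$, $\mathcal{M}(Y)$ is the family of bounded subsets of $Y$. $B(x,\delta)$ is the open ball. Suprema over the empty set of nonnegative quantities are taken to be $0$. Quasimeasure of noncompactness: a function $\Omega:\mathcal{M}(Y)\to\mathbb{R}_+$ such that (QMN1) for every $A\in\mathcal{M}(Y)$, $\Omega(A)=0$ if and only if $A$ is relatively compact; (QMN2) if $A,B\in\mathcal{M}(Y)$ and $A\subset B$ then $\Omega(A)\le\Omega(B)$; (QMN3) $\Omega(\overline{A})=\Omega(A)$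 for every $A\in\mathcal{M}(Y)$; (QMN4) $\Omega(\lambda A)=|\lambda|\,\Omega(A)$ for every $A\in\mathcal{M}(Y)$ and every scalar $\lambda$; (QMN5) for every finite $A$ and every $B\in\mathcal{M}(Y)$ with $A\cap B=\emptyset$, $\Omega(A\cup B)=\Omega(B)$. Functionals, for $\mathcal{F}\in\mathcal{M}(C^b(X,E))$: (1) $\eta(\mathcal{F}):=\sup_{x\in X}\beta(\{f(x): f\in\mathcal{F}\})$, where $\beta$ is the Hausdorff measure of noncompactness on $E$: $\beta(B)$ is the infimum of $\delta>0$ such that $B$ is covered by finitely many balls of radius $\delta$ with centers in $E$. (2) $\omega^x(\mathcal{F},\delta):=\sup_{f\in\mathcal{F}}\sup_{y\in B(x,\delta)}\|f(y)-f(x)\|_E$ for $x\in X$, $\delta>0$; $\omega_0^x(\mathcal{F}):=\lim_{\delta\to0}\omega^x(\mathcal{F},\delta)$; $\omega_0(\mathcal{F}):=\sup_{x\in X}\omega_0^x(\mathcal{F})$. (3) Fix a saturating sequence $(S_n)_{n\in\mathbb{N}}$ for $X$, that is, an ascending sequence of compact sets whose union is $X$. For $n\in\mathbb{N}$, $\varepsilon>0$ let $\chi^n(\mathcal{F},\varepsilon):=\sup\{d_{C^b(X,E)}(f,g): f,g\in\mathcal{F},\ d_{C(S_n,E)}(f,g)\le\varepsilon\}$; $\chi^n_0(\mathcal{F}):=\lim_{\varepsilon\to0}\chi^n(\mathcal{F},\varepsilon)$; $\chi_0(\mathcal{F}):=\lim_{n\to\infty}\chi_0^n(\mathcal{F})$.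 (These limits exist by monotonicity.) *)

theory Defs
  imports "HOL-Analysis.Analysis"
begin

instance bcontfun :: (metric_space, banach) banach ..

(* A Banach space over the reals or the complex numbers is modelled as a type of class banach (the
   underlying real Banach space) with a compatible multiplication by scalars from a type of class
   real_normed_field.  By the Gelfand-Mazur theorem the only such fields are, up to isometric
   isomorphism, the reals (then scaleK = scaleR) and the complex numbers. *)

locale normed_scalars = vector_space scaleK
  for scaleK :: "'k::real_normed_field \<Rightarrow> 'e::real_normed_vector \<Rightarrow> 'e" +
  assumes scaleK_of_real: "scaleK (of_real r) v = r *\<^sub>R v"
    and norm_scaleK: "norm (scaleK c v) = norm c * norm v"

lemma normed_scalars_scaleR: "normed_scalars (scaleR :: real \<Rightarrow> 'e::real_normed_vector \<Rightarrow> 'e)"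
  by unfold_locales (simp_all add: algebra_simps)

lemma normed_scalars_times: "normed_scalars ((*) :: 'k::real_normed_field \<Rightarrow> 'k \<Rightarrow> 'k)"
  by unfold_locales (simp_all add: algebra_simps norm_mult scaleR_conv_of_real)

definition bcontfun_scaleK ::
    "('k::real_normed_field \<Rightarrow> 'e::real_normed_vector \<Rightarrow> 'e) \<Rightarrow>
      'k \<Rightarrow> ('x::topological_space \<Rightarrow>\<^sub>C 'e) \<Rightarrow> ('x \<Rightarrow>\<^sub>C 'e)"
  where "bcontfun_scaleK scaleK c f = Bcontfun (\<lambda>x. scaleK c (apply_bcontfun f x))"

context normed_scalars
begin

lemma bounded_linear_scaleK: "bounded_linear (scaleK c)"
proof (rule bounded_linear_intro)
  show "scaleK c (v + w) = scaleK c v + scaleK c w" for v w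
    by (rule scale_right_distrib)
  show "scaleK c (r *\<^sub>R v) = r *\<^sub>R scaleK c v" for r v
    by (metis scaleK_of_real scale_left_commute)
  show "norm (scaleK c v) \<le> norm v * norm c" for v
    by (simp add: norm_scaleK mult.commute)
qed

lemma apply_bcontfun_scaleK [simp]:
  "apply_bcontfun (bcontfun_scaleK scaleK c f) x = scaleK c (apply_bcontfun f x)"
proof -
  have "(\<lambda>x. scaleK c (apply_bcontfun f x)) \<in> bcontfun"
  proof (rule bcontfun_normI)
    show "continuous_on UNIV (\<lambda>x. scaleK c (apply_bcontfun f x))"
      by (intro bounded_linear.continuous_on[OF bounded_linear_scaleK] continuous_on_apply_bcontfun)
    show "norm (scaleK c (apply_bcontfun f x)) \<le> norm c * norm f" for x
      by (simp add: norm_scaleK mult_left_mono norm_bounded)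
  qed
  then show ?thesis
    by (simp add: bcontfun_scaleK_def Bcontfun_inverse)
qed

lemma normed_scalars_bcontfun:
  "normed_scalars (bcontfun_scaleK scaleK :: 'k \<Rightarrow> ('x::topological_space \<Rightarrow>\<^sub>C 'e) \<Rightarrow> _)"
proof unfold_locales
  fix c and f :: "'x \<Rightarrow>\<^sub>C 'e"
  have le: "norm (bcontfun_scaleK scaleK c f) \<le> norm c * norm f" for c f
    by (rule norm_bound) (simp add: norm_scaleK mult_left_mono norm_bounded)
  show "norm (bcontfun_scaleK scaleK c f) = norm c * norm f"
  proof (cases "c = 0")
    case False
    have "f = bcontfun_scaleK scaleK (inverse c) (bcontfun_scaleK scaleK c f)"
      using False by (intro bcontfun_eqI) simp
    then have "norm f \<le> inverse (norm c) * norm (bcontfun_scaleK scaleK c f)"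
      by (metis le norm_inverse)
    with False le[of c f] show ?thesis by (simp add: field_simps)
  qed (use le[of c f] in simp)
qed (auto intro!: bcontfun_eqI simp: scaleK_of_real algebra_simps)

end

(* Values are taken in ennreal, where suprema over the empty set are 0 and monotone limits exist;
   finiteness on bounded sets expresses that the codomain is {0..<\<infinity>}. *)

locale quasimeasure_of_noncompactness = normed_scalars scaleK
  for scaleK :: "'k::real_normed_field \<Rightarrow> 'y::banach \<Rightarrow> 'y" +
  fixes \<Omega> :: "'y set \<Rightarrow> ennreal"
  assumes finite_value: "bounded A \<Longrightarrow> \<Omega> A < \<infinity>"
    and QMN1: "bounded A \<Longrightarrow> \<Omega> A = 0 \<longleftrightarrow> compact (closure A)"
    and QMN2: "bounded A \<Longrightarrow> bounded B \<Longrightarrow> A \<subseteq> B \<Longrightarrow> \<Omega> A \<le> \<Omega> B"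
    and QMN3: "bounded A \<Longrightarrow> \<Omega> (closure A) = \<Omega> A"
    and QMN4: "bounded A \<Longrightarrow> \<Omega> (scaleK c ` A) = ennreal (norm c) * \<Omega> A"
    and QMN5: "finite A \<Longrightarrow> bounded B \<Longrightarrow> A \<inter> B = {} \<Longrightarrow> \<Omega> (A \<union> B) = \<Omega> B"

definition hausdorff_mnc :: "'e::metric_space set \<Rightarrow> ennreal"
  where "hausdorff_mnc B =
    (INF \<delta>\<in>{\<delta>::real. \<delta> > 0 \<and> (\<exists>C. finite C \<and> B \<subseteq> (\<Union>c\<in>C. ball c \<delta>))}. ennreal \<delta>)"

definition eta :: "('x::topological_space \<Rightarrow>\<^sub>C 'e::metric_space) set \<Rightarrow> ennreal"
  where "eta F = (SUP x. hausdorff_mnc ((\<lambda>f. apply_bcontfun f x) ` F))"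

definition omega_at ::
    "'x::metric_space \<Rightarrow> ('x \<Rightarrow>\<^sub>C 'e::real_normed_vector) set \<Rightarrow> real \<Rightarrow> ennreal"
  where "omega_at x F \<delta> =
    (SUP f\<in>F. SUP y\<in>ball x \<delta>. ennreal (norm (apply_bcontfun f y - apply_bcontfun f x)))"

definition omega0_at :: "'x::metric_space \<Rightarrow> ('x \<Rightarrow>\<^sub>C 'e::real_normed_vector) set \<Rightarrow> ennreal"
  where "omega0_at x F = Lim (at_right 0) (omega_at x F)"

definition omega0 :: "('x::metric_space \<Rightarrow>\<^sub>C 'e::real_normed_vector) set \<Rightarrow> ennreal"
  where "omega0 F = (SUP x. omega0_at x F)"

definition saturating_sequence :: "(nat \<Rightarrow> 'x::topological_space set) \<Rightarrow> bool"
  where "saturating_sequence S \<longleftrightarrow> incseq S \<and> (\<forall>n. compact (S n)) \<and> (\<Union>n. S n) = UNIV"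

definition dist_on ::
    "'x::topological_space set \<Rightarrow> ('x \<Rightarrow>\<^sub>C 'e::real_normed_vector) \<Rightarrow> ('x \<Rightarrow>\<^sub>C 'e) \<Rightarrow> ennreal"
  where "dist_on D f g = (SUP x\<in>D. ennreal (norm (apply_bcontfun f x - apply_bcontfun g x)))"

(* dist on bounded continuous functions is the supremum distance over the whole space. *)
definition chi ::
    "'x::topological_space set \<Rightarrow> ('x \<Rightarrow>\<^sub>C 'e::real_normed_vector) set \<Rightarrow> real \<Rightarrow> ennreal"
  where "chi D F \<epsilon> = Sup {ennreal (dist f g) | f g. f \<in> F \<and> g \<in> F \<and> dist_on D f g \<le> ennreal \<epsilon>}"

definition chi0_on ::
    "'x::topological_space set \<Rightarrow> ('x \<Rightarrow>\<^sub>C 'e::real_normed_vector) set \<Rightarrow> ennreal"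
  where "chi0_on D F = Lim (at_right 0) (chi D F)"

definition chi0 ::
    "(nat \<Rightarrow> 'x::topological_space set) \<Rightarrow> ('x \<Rightarrow>\<^sub>C 'e::real_normed_vector) set \<Rightarrow> ennreal"
  where "chi0 S F = lim (\<lambda>n. chi0_on (S n) F)"

definition Omega ::
    "(nat \<Rightarrow> 'x::metric_space set) \<Rightarrow> ('x \<Rightarrow>\<^sub>C 'e::real_normed_vector) set \<Rightarrow> ennreal"
  where "Omega S F = eta F + omega0 F + chi0 S F"

end

(* Every functional is turned into an epsilon-delta criterion for "the value is at most b".
   QMN1 then becomes an Arzela-Ascoli argument in terms of finite nets: pointwise total boundedness
   and equicontinuity discretise the family on a compact S n, and chi0 = 0 says that closeness on
   some S n forces uniform closeness.  The sets S n need not absorb every compact set, but any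
   finite set of points lies in some S n, which is all that is used.  The delicate point of QMN5 is
   that chi0 does not grow when one function f is added: a member g1 of the family that is close to
   f on S n but far from f at a point x is compared with a member g2 that is close to f on an S m
   containing x.  The last claim follows from QMN1 and Mazur's theorem on convex hulls. *)

theory Submission
  imports Defs
begin

section \<open>Total boundedness\<close>

text \<open>By completeness, compactness of the closed set \<open>closure A\<close> is total
  boundedness. A net of \<open>A\<close> passes to its closure at the cost of doubling the radius: a
  finite union of closed balls of radius e/2 is closed, so it covers the closure as well. The
  centres may lie outside \<open>A\<close>.\<close>

lemma compact_closure_iff_finite_nets:
  fixes A :: "'a::complete_space set"
  shows "compact (closure A) \<longleftrightarrow> (\<forall>e>0. \<exists>C. finite C \<and> A \<subseteq> (\<Union>c\<in>C. ball c e))"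
proof
  assume "compact (closure A)"
  then show "\<forall>e>0. \<exists>C. finite C \<and> A \<subseteq> (\<Union>c\<in>C. ball c e)"
    using closure_subset[of A] unfolding compact_eq_totally_bounded by (meson order_trans)
next
  assume nets: "\<forall>e>0. \<exists>C. finite C \<and> A \<subseteq> (\<Union>c\<in>C. ball c e)"
  have "\<exists>C. finite C \<and> closure A \<subseteq> (\<Union>c\<in>C. ball c e)" if e: "e > 0" for e
  proof -
    obtain C where C: "finite C" "A \<subseteq> (\<Union>c\<in>C. ball c (e/2))"
      using nets half_gt_zero[OF e] by meson
    have "closure A \<subseteq> (\<Union>c\<in>C. cball c (e/2))"
    proof (rule closure_minimal)
      show "A \<subseteq> (\<Union>c\<in>C. cball c (e/2))" using C(2) by force
      show "closed (\<Union>c\<in>C. cball c (e/2))" using C(1) by (intro closed_UN) auto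
    qed
    also have "\<dots> \<subseteq> (\<Union>c\<in>C. ball c e)" using e by force
    finally show ?thesis using C(1) by blast
  qed
  then show "compact (closure A)"
    by (simp add: compact_eq_totally_bounded complete_eq_closed)
qed

text \<open>Mazur's theorem. The hull of a finite e/2-net \<open>C\<close> of \<open>A\<close> is
  compact, the hull of \<open>A\<close> stays within e/2 of it, and so an e/2-net of
  \<open>convex hull C\<close> is an e-net of \<open>convex hull A\<close>.\<close>

lemma compact_closure_convex_hull:
  fixes A :: "'a::banach set"
  assumes "compact (closure A)"
  shows "compact (closure (convex hull A))"
  unfolding compact_closure_iff_finite_nets
proof (intro allI impI)
  fix e :: real assume e: "e > 0"
  obtain C where C: "finite C" "A \<subseteq> (\<Union>c\<in>C. ball c (e/2))"
    using assms half_gt_zero[OF e] unfolding compact_closure_iff_finite_nets by meson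
  \<comment> \<open>The Minkowski sum of \<open>convex hull C\<close> and the ball, spelled in the
    form that \<open>convex_sums\<close> proves convex.\<close>
  let ?T = "\<Union>x\<in>convex hull C. \<Union>y\<in>ball 0 (e/2). {x + y}"
  have "convex ?T" by (intro convex_sums convex_convex_hull convex_ball)
  moreover have "A \<subseteq> ?T"
  proof
    fix a assume "a \<in> A"
    then obtain c where "c \<in> C" "dist c a < e/2" using C(2) by auto
    then have "c \<in> convex hull C" "a - c \<in> ball 0 (e/2)" "a = c + (a - c)"
      by (auto simp: hull_inc dist_norm norm_minus_commute)
    then show "a \<in> ?T" by blast
  qed
  ultimately have hull: "convex hull A \<subseteq> ?T" by (rule hull_minimal[rotated])
  have "compact (convex hull C)" using C(1) by (rule finite_imp_compact_convex_hull)
  then obtain D where D: "finite D" "convex hull C \<subseteq> (\<Union>d\<in>D. ball d (e/2))"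
    using half_gt_zero[OF e] unfolding compact_eq_totally_bounded by meson
  have "convex hull A \<subseteq> (\<Union>d\<in>D. ball d e)"
  proof
    fix a assume "a \<in> convex hull A"
    then obtain x y where xy: "x \<in> convex hull C" "norm y < e/2" "a = x + y" using hull by auto
    then obtain d where d: "d \<in> D" "dist d x < e/2" using D(2) by auto
    have "dist d a \<le> dist d x + dist x a" by (rule dist_triangle)
    then have "dist d a < e" using xy d(2) by (simp add: dist_norm)
    then show "a \<in> (\<Union>d\<in>D. ball d e)" using d(1) by auto
  qed
  then show "\<exists>C. finite C \<and> convex hull A \<subseteq> (\<Union>c\<in>C. ball c e)" using D(1) by blast
qed

section \<open>Epsilon-delta criteria for the functionals\<close>

text \<open>Lets two functionals be compared through their criteria, which speak of real bounds
  only; if \<open>y\<close> is infinite there is nothing to show.\<close>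

lemma ennreal_le_by_real_bounds:
  assumes "\<And>b. b \<ge> 0 \<Longrightarrow> y \<le> ennreal b \<Longrightarrow> x \<le> ennreal b"
  shows "x \<le> y"
  using assms by (cases y) auto

text \<open>The infimum need not be attained, so only values below each \<open>a > b\<close> can be
  asked for. This slack recurs in all criteria below.\<close>

lemma INF_le_ennreal_iff:
  assumes "b \<ge> 0"
  shows "(INF i\<in>I. f i) \<le> ennreal b \<longleftrightarrow> (\<forall>a>b. \<exists>i\<in>I. f i < ennreal a)"
proof
  assume "(INF i\<in>I. f i) \<le> ennreal b"
  then show "\<forall>a>b. \<exists>i\<in>I. f i < ennreal a"
    using assms by (auto simp flip: INF_less_iff intro: le_less_trans ennreal_lessI)
next
  assume less: "\<forall>a>b. \<exists>i\<in>I. f i < ennreal a"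
  show "(INF i\<in>I. f i) \<le> ennreal b"
  proof (rule ennreal_le_epsilon)
    fix e :: real assume "e > 0"
    then obtain i where "i \<in> I" "f i < ennreal (b + e)" using less by (metis less_add_same_cancel1)
    then show "(INF i\<in>I. f i) \<le> ennreal b + ennreal e"
      using assms \<open>e > 0\<close> by (metis INF_lower2 ennreal_plus less_imp_le)
  qed
qed

text \<open>\<open>Lim\<close> is a definite description; monotonicity guarantees that the limit
  exists and identifies it with an infimum.\<close>

lemma Lim_at_right_0_mono:
  fixes f :: "real \<Rightarrow> ennreal"
  assumes "\<And>s t. s \<le> t \<Longrightarrow> f s \<le> f t"
  shows "Lim (at_right 0) f = (INF t\<in>{0<..}. f t)"
proof -
  have "(f \<longlongrightarrow> Inf (f ` ({0<..} \<inter> UNIV))) (at 0 within ({0<..} \<inter> UNIV))"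
    by (rule Lim_right_bound[where K = 0]) (auto intro: assms)
  then show ?thesis by (intro tendsto_Lim) auto
qed

section \<open>Criteria for \<open>eta\<close> and \<open>omega0\<close>\<close>

lemma hausdorff_mnc_le_iff:
  assumes "b \<ge> 0"
  shows "hausdorff_mnc B \<le> ennreal b \<longleftrightarrow>
    (\<forall>a>b. \<exists>C. finite C \<and> B \<subseteq> (\<Union>c\<in>C. ball c a))" (is "_ \<longleftrightarrow> ?nets")
proof
  assume "hausdorff_mnc B \<le> ennreal b"
  then have *: "\<forall>a>b. \<exists>\<delta>\<in>{\<delta>. \<delta> > 0 \<and> (\<exists>C. finite C \<and> B \<subseteq> (\<Union>c\<in>C. ball c \<delta>))}.
      ennreal \<delta> < ennreal a"
    unfolding hausdorff_mnc_def INF_le_ennreal_iff[OF assms] .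
  show ?nets
  proof (intro allI impI)
    fix a assume "a > b"
    with * obtain \<delta> where "\<delta> \<in> {\<delta>. \<delta> > 0 \<and> (\<exists>C. finite C \<and> B \<subseteq> (\<Union>c\<in>C. ball c \<delta>))}"
      and "ennreal \<delta> < ennreal a" by meson
    then obtain C where C: "\<delta> > 0" "finite C" "B \<subseteq> (\<Union>c\<in>C. ball c \<delta>)"
        "ennreal \<delta> < ennreal a"
      by auto
    have "\<delta> \<le> a" using C(1,4) by (simp add: ennreal_less_iff)
    then have "(\<Union>c\<in>C. ball c \<delta>) \<subseteq> (\<Union>c\<in>C. ball c a)" by force
    with C(3) have "B \<subseteq> (\<Union>c\<in>C. ball c a)" by (rule order_trans)
    with C(2) show "\<exists>C. finite C \<and> B \<subseteq> (\<Union>c\<in>C. ball c a)" by (intro exI conjI)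
  qed
next
  assume nets: ?nets
  show "hausdorff_mnc B \<le> ennreal b"
    unfolding hausdorff_mnc_def INF_le_ennreal_iff[OF assms]
  proof (intro allI impI)
    fix a assume "a > b"
    \<comment> \<open>The infimum criterion asks for a positive radius strictly below
      \<open>a\<close>; any \<open>t\<close> between \<open>b\<close> and \<open>a\<close> is one,
      since \<open>b\<close> is nonnegative.\<close>
    then obtain t where "b < t" "t < a" using dense by blast
    with nets assms show "\<exists>i\<in>{\<delta>. \<delta> > 0 \<and> (\<exists>C. finite C \<and> B \<subseteq> (\<Union>c\<in>C. ball c \<delta>))}. ennreal i < ennreal a"
      by (intro bexI[of _ t]) (auto simp: ennreal_less_iff)
  qed
qed

lemma eta_le_iff:
  assumes "b \<ge> 0"
  shows "eta F \<le> ennreal b \<longleftrightarrow>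
    (\<forall>x. \<forall>a>b. \<exists>C. finite C \<and> (\<forall>f\<in>F. \<exists>c\<in>C. dist c (apply_bcontfun f x) < a))"
proof -
  have "(\<lambda>f. apply_bcontfun f x) ` F \<subseteq> (\<Union>c\<in>C. ball c a) \<longleftrightarrow>
      (\<forall>f\<in>F. \<exists>c\<in>C. dist c (apply_bcontfun f x) < a)" for x C a
    by (simp add: image_subset_iff)
  then show ?thesis
    by (simp add: eta_def SUP_le_iff hausdorff_mnc_le_iff[OF assms])
qed

lemma omega0_at_eq: "omega0_at x F = (INF \<delta>\<in>{0<..}. omega_at x F \<delta>)"
  unfolding omega0_at_def omega_at_def
  by (intro Lim_at_right_0_mono SUP_mono' SUP_subset_mono subset_ball order_refl)

lemma omega_at_le_iff:
  assumes "a \<ge> 0"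
  shows "omega_at x F \<delta> \<le> ennreal a \<longleftrightarrow>
    (\<forall>f\<in>F. \<forall>y\<in>ball x \<delta>. dist (apply_bcontfun f y) (apply_bcontfun f x) \<le> a)"
  using assms by (simp add: omega_at_def SUP_le_iff dist_norm)

lemma omega0_le_iff:
  assumes "b \<ge> 0"
  shows "omega0 F \<le> ennreal b \<longleftrightarrow> (\<forall>x. \<forall>a>b. \<exists>\<delta>>0. \<forall>f\<in>F. \<forall>y\<in>ball x \<delta>.
    dist (apply_bcontfun f y) (apply_bcontfun f x) \<le> a)" (is "_ \<longleftrightarrow> ?osc")
proof
  assume le: "omega0 F \<le> ennreal b"
  show ?osc
  proof (intro allI impI)
    fix x a assume a: "a > b"
    have "omega0_at x F \<le> ennreal b" using le by (simp add: omega0_def SUP_le_iff)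
    then obtain \<delta> where "\<delta> > 0" "omega_at x F \<delta> < ennreal a"
      using a unfolding omega0_at_eq INF_le_ennreal_iff[OF assms] by auto
    then show "\<exists>\<delta>>0. \<forall>f\<in>F. \<forall>y\<in>ball x \<delta>. dist (apply_bcontfun f y) (apply_bcontfun f x) \<le> a"
      using a assms omega_at_le_iff[of a x F \<delta>] by auto
  qed
next
  assume osc: ?osc
  have "\<exists>\<delta>\<in>{0<..}. omega_at x F \<delta> < ennreal a" if a: "a > b" for x a
  proof -
    \<comment> \<open>The oscillation bound is not strict, so it is taken at an intermediate
      \<open>t\<close> to end strictly below \<open>a\<close>.\<close>
    obtain t where t: "b < t" "t < a" using a dense by blast
    with osc obtain \<delta> where \<delta>: "\<delta> > 0"
      "\<forall>f\<in>F. \<forall>y\<in>ball x \<delta>. dist (apply_bcontfun f y) (apply_bcontfun f x) \<le> t"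
      by meson
    have "t \<ge> 0" using t assms by simp
    then have "omega_at x F \<delta> \<le> ennreal t" using \<delta>(2) by (simp add: omega_at_le_iff)
    also have "\<dots> < ennreal a" using t assms by (intro ennreal_lessI) auto
    finally show ?thesis using \<delta>(1) by auto
  qed
  then show "omega0 F \<le> ennreal b"
    by (simp add: omega0_def SUP_le_iff omega0_at_eq INF_le_ennreal_iff[OF assms])
qed

section \<open>Criterion for \<open>chi0\<close>\<close>

lemma dist_on_le_iff:
  assumes "e \<ge> 0"
  shows "dist_on D f g \<le> ennreal e \<longleftrightarrow>
    (\<forall>x\<in>D. dist (apply_bcontfun f x) (apply_bcontfun g x) \<le> e)"
  using assms by (simp add: dist_on_def SUP_le_iff dist_norm)

lemma chi_le_iff:
  assumes "a \<ge> 0" "e \<ge> 0"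
  shows "chi D F e \<le> ennreal a \<longleftrightarrow> (\<forall>f\<in>F. \<forall>g\<in>F.
    (\<forall>x\<in>D. dist (apply_bcontfun f x) (apply_bcontfun g x) \<le> e) \<longrightarrow> dist f g \<le> a)"
proof -
  have "chi D F e \<le> ennreal a \<longleftrightarrow>
      (\<forall>f\<in>F. \<forall>g\<in>F. dist_on D f g \<le> ennreal e \<longrightarrow> ennreal (dist f g) \<le> ennreal a)"
    unfolding chi_def Sup_le_iff by blast
  then show ?thesis using assms by (simp add: dist_on_le_iff)
qed

lemma chi0_on_eq: "chi0_on D F = (INF e\<in>{0<..}. chi D F e)"
  unfolding chi0_on_def
proof (rule Lim_at_right_0_mono)
  fix s t :: real assume "s \<le> t"
  then have "ennreal s \<le> ennreal t" by (rule ennreal_leI)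
  then show "chi D F s \<le> chi D F t"
    unfolding chi_def by (intro Sup_subset_mono) (blast intro: order_trans)
qed

text \<open>Closeness on the larger set is the stricter condition, so fewer pairs compete in the
  supremum. Along an ascending \<open>S\<close> the values therefore decrease, which yields the
  limit in \<open>chi0\<close>.\<close>

lemma chi0_on_antimono:
  assumes "D \<subseteq> D'"
  shows "chi0_on D' F \<le> chi0_on D F"
proof -
  have "dist_on D f g \<le> dist_on D' f g" for f g :: "'a \<Rightarrow>\<^sub>C 'b"
    unfolding dist_on_def using assms by (intro SUP_subset_mono) auto
  then have "chi D' F e \<le> chi D F e" for e
    unfolding chi_def by (intro Sup_subset_mono) (blast intro: order_trans)
  then show ?thesis unfolding chi0_on_eq by (intro INF_mono') auto
qed

lemma chi0_eq:
  assumes "incseq S"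
  shows "chi0 S F = (INF n. chi0_on (S n) F)"
  unfolding chi0_def
  by (intro limI LIMSEQ_INF antimonoI chi0_on_antimono monoD[OF assms])

lemma chi0_le_iff:
  assumes "incseq S" "b \<ge> 0"
  shows "chi0 S F \<le> ennreal b \<longleftrightarrow> (\<forall>a>b. \<exists>n. \<exists>e>0. \<forall>f\<in>F. \<forall>g\<in>F.
    (\<forall>x\<in>S n. dist (apply_bcontfun f x) (apply_bcontfun g x) \<le> e) \<longrightarrow> dist f g \<le> a)"
    (is "_ \<longleftrightarrow> (\<forall>a>b. ?close a)")
proof -
  have iff: "?close a \<longleftrightarrow> (\<exists>n. \<exists>e>0. chi (S n) F e \<le> ennreal a)" if "a > b" for a
  proof -
    have "a \<ge> 0" using that assms(2) by simp
    then show ?thesis using chi_le_iff[of a _ "S _" F] by (meson less_imp_le)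
  qed
  \<comment> \<open>The limits in \<open>n\<close> and \<open>e\<close> merge into one infimum over
    pairs, so that \<open>INF_le_ennreal_iff\<close> needs to be applied only once.\<close>
  have "chi0 S F = (INF p\<in>UNIV \<times> {0<..}. chi (S (fst p)) F (snd p))"
    unfolding chi0_eq[OF assms(1)] chi0_on_eq
  proof (rule antisym)
    show "(INF n. INF e\<in>{0<..}. chi (S n) F e) \<le> (INF p\<in>UNIV \<times> {0<..}. chi (S (fst p)) F (snd p))"
    proof (rule INF_greatest)
      fix p :: "nat \<times> real" assume "p \<in> UNIV \<times> {0<..}"
      then have "snd p \<in> {0<..}" by auto
      then show "(INF n. INF e\<in>{0<..}. chi (S n) F e) \<le> chi (S (fst p)) F (snd p)"
        by (intro INF_lower2[of "fst p"] INF_lower UNIV_I)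
    qed
  qed (auto intro!: INF_greatest intro: INF_lower2)
  then have "chi0 S F \<le> ennreal b \<longleftrightarrow> (\<forall>a>b. \<exists>n. \<exists>e>0. chi (S n) F e < ennreal a)"
    by (auto simp: INF_le_ennreal_iff[OF assms(2)] Bex_def)
  also have "\<dots> \<longleftrightarrow> (\<forall>a>b. \<exists>n. \<exists>e>0. chi (S n) F e \<le> ennreal a)"
  proof (intro iffI allI impI)
    fix a assume le: "\<forall>a>b. \<exists>n. \<exists>e>0. chi (S n) F e \<le> ennreal a" and a: "a > b"
    obtain t where t: "b < t" "t < a" using a dense by blast
    with le obtain n e where e: "e > 0" "chi (S n) F e \<le> ennreal t" by blast
    have "ennreal t < ennreal a" using t assms(2) by (intro ennreal_lessI) auto
    with e show "\<exists>n. \<exists>e>0. chi (S n) F e < ennreal a" by (meson le_less_trans)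
  qed (blast intro: less_imp_le)
  also have "\<dots> \<longleftrightarrow> (\<forall>a>b. ?close a)" using iff by blast
  finally show ?thesis .
qed

section \<open>The axioms of a quasimeasure\<close>

text \<open>Used where a point witnesses that two functions are far apart: it can be caught in an
  \<open>S m\<close> beyond any prescribed index.\<close>

lemma saturating_sequence_point:
  assumes "saturating_sequence S"
  obtains m where "m \<ge> n" "x \<in> S m"
proof -
  have "x \<in> (\<Union>k. S k)" using assms by (simp add: saturating_sequence_def)
  then obtain k where "x \<in> S k" by blast
  moreover have "S k \<subseteq> S (max n k)"
    using assms by (auto simp: saturating_sequence_def incseq_def)
  ultimately show thesis using that[of "max n k"] by auto
qed

section \<open>Monotonicity and finiteness\<close>

lemma Omega_mono:
  assumes "incseq S" "F \<subseteq> G"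
  shows "Omega S F \<le> Omega S G"
proof -
  have "(\<lambda>f. apply_bcontfun f x) ` F \<subseteq> (\<lambda>f. apply_bcontfun f x) ` G" for x
    using assms(2) by (rule image_mono)
  then have "eta F \<le> eta G"
    unfolding eta_def hausdorff_mnc_def
    by (intro SUP_mono' INF_superset_mono order_refl Collect_mono) (meson order_trans)
  moreover have "omega0 F \<le> omega0 G"
    unfolding omega0_def omega0_at_eq omega_at_def
    using assms(2) by (intro SUP_mono' INF_mono' SUP_subset_mono order_refl)
  moreover have "chi0 S F \<le> chi0 S G"
    unfolding chi0_eq[OF assms(1)] chi0_on_eq chi_def
    using assms(2) by (intro INF_mono' Sup_subset_mono) blast
  ultimately show ?thesis unfolding Omega_def by (intro add_mono)
qed

text \<open>If all norms are at most \<open>M\<close>, then balls around 0 cover the values, and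
  oscillations and mutual distances are at most \<open>2 * M\<close>. The witnesses 1 for the
  radius, the index and the tolerance are arbitrary.\<close>

lemma Omega_finite:
  fixes F :: "('x::metric_space \<Rightarrow>\<^sub>C 'e::real_normed_vector) set"
  assumes "incseq S" "bounded F"
  shows "Omega S F < \<infinity>"
proof -
  obtain M where M: "M > 0" "\<And>f. f \<in> F \<Longrightarrow> norm f \<le> M"
    using assms(2) by (auto simp: bounded_pos)
  then have val: "norm (apply_bcontfun f x) \<le> M" if "f \<in> F" for f x
    using that by (meson norm_bounded order_trans)
  have osc: "dist (apply_bcontfun f y) (apply_bcontfun f x) \<le> 2 * M" if "f \<in> F" for f x y
    using norm_triangle_ineq4[of "apply_bcontfun f y" "apply_bcontfun f x"]
      val[OF that, of x] val[OF that, of y] by (simp add: dist_norm)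
  have diam: "dist f g \<le> 2 * M" if "f \<in> F" "g \<in> F" for f g
    using norm_triangle_ineq4[of f g] M(2)[OF that(1)] M(2)[OF that(2)] by (simp add: dist_norm)
  have "eta F \<le> ennreal M"
    using M(1) le_less_trans[OF val] by (auto simp: eta_le_iff intro!: exI[of _ "{0}"])
  moreover have "omega0 F \<le> ennreal (2 * M)"
    using M(1) order_trans[OF osc less_imp_le] by (auto simp: omega0_le_iff intro!: exI[of _ 1])
  moreover have "chi0 S F \<le> ennreal (2 * M)"
    using M(1) order_trans[OF diam less_imp_le]
    by (auto simp: chi0_le_iff[OF assms(1)] intro!: exI[of _ 1])
  ultimately have "Omega S F \<le> ennreal M + ennreal (2 * M) + ennreal (2 * M)"
    unfolding Omega_def by (intro add_mono)
  also have "\<dots> < \<infinity>" by (simp add: ennreal_add_less_top)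
  finally show ?thesis .
qed

section \<open>Invariance under closure and under adding finitely many functions\<close>

text \<open>A function in the closure has a member of the family uniformly near it. The gap between
  \<open>b\<close> and \<open>a\<close> pays for this error: the family is used at the midpoint
  \<open>(a + b) / 2\<close>, which leaves \<open>(a - b) / 2\<close>.\<close>

lemma Omega_closure:
  assumes "incseq S"
  shows "Omega S (closure F) = Omega S F"
proof (rule antisym)
  have approx: "\<exists>g\<in>F. dist g f < t \<and> (\<forall>x. dist (apply_bcontfun g x) (apply_bcontfun f x) < t)"
    if f: "f \<in> closure F" "t > 0" for f t
  proof -
    obtain g where "g \<in> F" "dist g f < t" using f closure_approachable by blast
    then show ?thesis using dist_bounded[of g _ f] by (meson le_less_trans)
  qed
  have "eta (closure F) \<le> eta F"
  proof (rule ennreal_le_by_real_bounds)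
    fix b :: real assume b: "b \<ge> 0" "eta F \<le> ennreal b"
    show "eta (closure F) \<le> ennreal b"
      unfolding eta_le_iff[OF b(1)]
    proof (intro allI impI)
      fix x a assume "a > b"
      then have t: "(a + b) / 2 > b" "(a - b) / 2 > 0" by auto
      obtain C where C: "finite C" "\<forall>f\<in>F. \<exists>c\<in>C. dist c (apply_bcontfun f x) < (a + b) / 2"
        using b t(1) unfolding eta_le_iff[OF b(1)] by blast
      have "\<exists>c\<in>C. dist c (apply_bcontfun f x) < a" if f: "f \<in> closure F" for f
      proof -
        obtain g where g: "g \<in> F" "dist (apply_bcontfun g x) (apply_bcontfun f x) < (a - b) / 2"
          using approx[OF f t(2)] by blast
        obtain c where c: "c \<in> C" "dist c (apply_bcontfun g x) < (a + b) / 2" using C(2) g(1) by blast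
        have "dist c (apply_bcontfun f x) < a"
          using dist_triangle[of c "apply_bcontfun f x" "apply_bcontfun g x"] c(2) g(2)
          by (simp add: field_simps)
        then show ?thesis using c(1) by blast
      qed
      then show "\<exists>C. finite C \<and> (\<forall>f\<in>closure F. \<exists>c\<in>C. dist c (apply_bcontfun f x) < a)"
        using C(1) by blast
    qed
  qed
  moreover have "omega0 (closure F) \<le> omega0 F"
  proof (rule ennreal_le_by_real_bounds)
    fix b :: real assume b: "b \<ge> 0" "omega0 F \<le> ennreal b"
    show "omega0 (closure F) \<le> ennreal b"
      unfolding omega0_le_iff[OF b(1)]
    proof (intro allI impI)
      fix x a assume "a > b"
      \<comment> \<open>The approximation error enters twice, at \<open>x\<close> and at
        \<open>y\<close>, hence a quarter of the gap.\<close>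
      then have t: "(a + b) / 2 > b" "(a - b) / 4 > 0" by auto
      obtain \<delta> where \<delta>: "\<delta> > 0"
        "\<forall>f\<in>F. \<forall>y\<in>ball x \<delta>. dist (apply_bcontfun f y) (apply_bcontfun f x) \<le> (a + b) / 2"
        using b t(1) unfolding omega0_le_iff[OF b(1)] by blast
      have "dist (apply_bcontfun f y) (apply_bcontfun f x) \<le> a"
        if f: "f \<in> closure F" and y: "y \<in> ball x \<delta>" for f y
      proof -
        obtain g where g: "g \<in> F"
          "\<And>x. dist (apply_bcontfun g x) (apply_bcontfun f x) < (a - b) / 4"
          using approx[OF f t(2)] by blast
        have "dist (apply_bcontfun g y) (apply_bcontfun g x) \<le> (a + b) / 2"
          using \<delta>(2) g(1) y by blast
        then show ?thesis
          using g(2)[of x] g(2)[of y]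
            dist_triangle[of "apply_bcontfun f y" "apply_bcontfun f x" "apply_bcontfun g y"]
            dist_triangle[of "apply_bcontfun g y" "apply_bcontfun f x" "apply_bcontfun g x"]
          by (simp add: dist_commute field_simps)
      qed
      then show "\<exists>\<delta>>0. \<forall>f\<in>closure F. \<forall>y\<in>ball x \<delta>.
          dist (apply_bcontfun f y) (apply_bcontfun f x) \<le> a"
        using \<delta>(1) by blast
    qed
  qed
  moreover have "chi0 S (closure F) \<le> chi0 S F"
  proof (rule ennreal_le_by_real_bounds)
    fix b :: real assume b: "b \<ge> 0" "chi0 S F \<le> ennreal b"
    show "chi0 S (closure F) \<le> ennreal b"
      unfolding chi0_le_iff[OF assms b(1)]
    proof (intro allI impI)
      fix a assume "a > b"
      then have t: "(a + b) / 2 > b" "(a - b) / 4 > 0" by auto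
      obtain n e where e: "e > 0" and F: "\<And>f g. f \<in> F \<Longrightarrow> g \<in> F \<Longrightarrow>
          (\<forall>x\<in>S n. dist (apply_bcontfun f x) (apply_bcontfun g x) \<le> e) \<Longrightarrow> dist f g \<le> (a + b) / 2"
        using b t(1) unfolding chi0_le_iff[OF assms b(1)] by blast
      have "dist f g \<le> a" if f: "f \<in> closure F" and g: "g \<in> closure F"
        and fg: "\<forall>x\<in>S n. dist (apply_bcontfun f x) (apply_bcontfun g x) \<le> e / 3" for f g
      proof -
        \<comment> \<open>Both functions are replaced, each at cost \<open>s\<close>. The bound
          \<open>e / 3\<close> keeps the replacements within \<open>e\<close> on \<open>S n\<close>;
          the bound \<open>(a - b) / 4\<close> takes the uniform distance from
          \<open>(a + b) / 2\<close> to at most \<open>a\<close>.\<close>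
        define s where "s = min ((a - b) / 4) (e / 3)"
        have s: "s > 0" "s \<le> (a - b) / 4" "s \<le> e / 3" using t e unfolding s_def by linarith+
        obtain f' where f': "f' \<in> F" "dist f' f < s"
          "\<And>x. dist (apply_bcontfun f' x) (apply_bcontfun f x) < s"
          using approx[OF f s(1)] by blast
        obtain g' where g': "g' \<in> F" "dist g' g < s"
          "\<And>x. dist (apply_bcontfun g' x) (apply_bcontfun g x) < s"
          using approx[OF g s(1)] by blast
        have "dist (apply_bcontfun f' x) (apply_bcontfun g' x) \<le> e" if "x \<in> S n" for x
          using f'(3)[of x] g'(3)[of x] fg that s(3)
            dist_triangle[of "apply_bcontfun f' x" "apply_bcontfun g' x" "apply_bcontfun f x"]
            dist_triangle[of "apply_bcontfun f x" "apply_bcontfun g' x" "apply_bcontfun g x"]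
          by (fastforce simp: dist_commute)
        then have "dist f' g' \<le> (a + b) / 2" using F f'(1) g'(1) by blast
        then show ?thesis
          using f'(2) g'(2) s(2) dist_triangle[of f g f'] dist_triangle[of f' g g']
          by (simp add: dist_commute field_simps)
      qed
      then show "\<exists>n. \<exists>e>0. \<forall>f\<in>closure F. \<forall>g\<in>closure F.
          (\<forall>x\<in>S n. dist (apply_bcontfun f x) (apply_bcontfun g x) \<le> e) \<longrightarrow> dist f g \<le> a"
        using e by (intro exI[of _ n] exI[of _ "e / 3"]) auto
    qed
  qed
  ultimately show "Omega S (closure F) \<le> Omega S F"
    unfolding Omega_def by (intro add_mono)
qed (rule Omega_mono[OF assms closure_subset])

text \<open>The induction step for QMN5. For \<open>eta\<close> the value of \<open>f\<close>
  becomes an extra centre, for \<open>omega0\<close> continuity of \<open>f\<close> supplies a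
  second radius; the work lies in \<open>chi0\<close>.\<close>

lemma Omega_insert:
  assumes "saturating_sequence S"
  shows "Omega S (insert f F) = Omega S F"
proof (rule antisym)
  have S: "incseq S" using assms by (simp add: saturating_sequence_def)
  have "eta (insert f F) \<le> eta F"
  proof (rule ennreal_le_by_real_bounds)
    fix b :: real assume b: "b \<ge> 0" "eta F \<le> ennreal b"
    show "eta (insert f F) \<le> ennreal b"
      unfolding eta_le_iff[OF b(1)]
    proof (intro allI impI)
      fix x a assume a: "a > b"
      then obtain C where "finite C" "\<forall>g\<in>F. \<exists>c\<in>C. dist c (apply_bcontfun g x) < a"
        using b unfolding eta_le_iff[OF b(1)] by blast
      then show "\<exists>C. finite C \<and> (\<forall>g\<in>insert f F. \<exists>c\<in>C. dist c (apply_bcontfun g x) < a)"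
        using a b(1) by (intro exI[of _ "insert (apply_bcontfun f x) C"]) auto
    qed
  qed
  moreover have "omega0 (insert f F) \<le> omega0 F"
  proof (rule ennreal_le_by_real_bounds)
    fix b :: real assume b: "b \<ge> 0" "omega0 F \<le> ennreal b"
    show "omega0 (insert f F) \<le> ennreal b"
      unfolding omega0_le_iff[OF b(1)]
    proof (intro allI impI)
      fix x a assume a: "a > b"
      then obtain \<delta> where \<delta>: "\<delta> > 0"
        "\<forall>g\<in>F. \<forall>y\<in>ball x \<delta>. dist (apply_bcontfun g y) (apply_bcontfun g x) \<le> a"
        using b unfolding omega0_le_iff[OF b(1)] by blast
      have "continuous_on UNIV (apply_bcontfun f)" by (rule continuous_on_apply_bcontfun)
      then obtain \<delta>' where \<delta>': "\<delta>' > 0"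
        "\<forall>y. dist y x < \<delta>' \<longrightarrow> dist (apply_bcontfun f y) (apply_bcontfun f x) < a"
        using a b(1) unfolding continuous_on_iff by (meson UNIV_I le_less_trans)
      show "\<exists>\<delta>>0. \<forall>g\<in>insert f F. \<forall>y\<in>ball x \<delta>.
          dist (apply_bcontfun g y) (apply_bcontfun g x) \<le> a"
        using \<delta> \<delta>' by (intro exI[of _ "min \<delta> \<delta>'"]) (auto simp: dist_commute intro: less_imp_le)
    qed
  qed
  moreover have "chi0 S (insert f F) \<le> chi0 S F"
  proof (rule ennreal_le_by_real_bounds)
    fix b :: real assume b: "b \<ge> 0" "chi0 S F \<le> ennreal b"
    show "chi0 S (insert f F) \<le> ennreal b"
      unfolding chi0_le_iff[OF S b(1)]
    proof (intro allI impI)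
      fix a assume a: "a > b"
      then have t: "(a + b) / 2 > b" "(a - b) / 2 > 0" by auto
      obtain n e where e: "e > 0" and F: "\<And>g h. g \<in> F \<Longrightarrow> h \<in> F \<Longrightarrow>
          (\<forall>x\<in>S n. dist (apply_bcontfun g x) (apply_bcontfun h x) \<le> e) \<Longrightarrow> dist g h \<le> (a + b) / 2"
        using b t(1) unfolding chi0_le_iff[OF S b(1)] by blast
      \<comment> \<open>It suffices to control pairs containing \<open>f\<close>. The constraints
        \<open>m \<ge> n\<close> and \<open>s \<le> e\<close> ensure that the criterion for pairs
        inside \<open>F\<close> remains available.\<close>
      have "\<exists>m\<ge>n. \<exists>s>0. s \<le> e \<and> (\<forall>g\<in>F.
          (\<forall>x\<in>S m. dist (apply_bcontfun f x) (apply_bcontfun g x) \<le> s) \<longrightarrow> dist f g \<le> a)"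
      proof (rule ccontr)
        assume "\<not> ?thesis"
        then have far: "\<exists>g\<in>F. (\<forall>x\<in>S m. dist (apply_bcontfun f x) (apply_bcontfun g x) \<le> s) \<and>
            \<not> dist f g \<le> a" if "m \<ge> n" "s > 0" "s \<le> e" for m s
          using that by blast
        \<comment> \<open>The negated claim is used twice: first at \<open>S n\<close>, then at an
          \<open>S m\<close> chosen after the point \<open>x\<close> at which \<open>g1\<close> is
          far from \<open>f\<close>.\<close>
        obtain g1 where g1: "g1 \<in> F" "\<not> dist f g1 \<le> a"
          "\<And>x. x \<in> S n \<Longrightarrow> dist (apply_bcontfun f x) (apply_bcontfun g1 x) \<le> e / 2"
          using far[of n "e / 2"] e by auto
        obtain x where x: "dist (apply_bcontfun f x) (apply_bcontfun g1 x) > a"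
          using g1(2) dist_bound[of f g1 a] by (meson not_le)
        obtain m where m: "m \<ge> n" "x \<in> S m" using saturating_sequence_point[OF assms] .
        \<comment> \<open>The two tolerances \<open>e / 2\<close> put \<open>g1\<close> and
          \<open>g2\<close> within \<open>e\<close> on \<open>S n\<close>, so they are uniformly
          within \<open>(a + b) / 2\<close>. With error \<open>(a - b) / 2\<close> at
          \<open>x\<close>, the distance from \<open>f\<close> to \<open>g1\<close> there would be
          at most \<open>a\<close>.\<close>
        obtain g2 where g2: "g2 \<in> F" "\<And>x. x \<in> S m \<Longrightarrow>
            dist (apply_bcontfun f x) (apply_bcontfun g2 x) \<le> min (e / 2) ((a - b) / 2)"
          using far[OF m(1), of "min (e / 2) ((a - b) / 2)"] e t(2) by (auto simp: min_le_iff_disj)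
        have "dist (apply_bcontfun g1 y) (apply_bcontfun g2 y) \<le> e" if "y \<in> S n" for y
        proof -
          have "y \<in> S m" using that m(1) S by (auto simp: incseq_def)
          then show ?thesis
            using g1(3)[OF that] g2(2)[of y]
              dist_triangle[of "apply_bcontfun g1 y" "apply_bcontfun g2 y" "apply_bcontfun f y"]
            by (simp add: dist_commute)
        qed
        then have "dist g1 g2 \<le> (a + b) / 2" using F g1(1) g2(1) by blast
        then have "dist (apply_bcontfun g1 x) (apply_bcontfun g2 x) \<le> (a + b) / 2"
          using dist_bounded[of g1 x g2] by simp
        then show False
          using x g2(2)[OF m(2)]
            dist_triangle[of "apply_bcontfun f x" "apply_bcontfun g1 x" "apply_bcontfun g2 x"]
          by (simp add: dist_commute field_simps)
      qed
      then obtain m s where m: "m \<ge> n" "s > 0" "s \<le> e" and f: "\<And>g. g \<in> F \<Longrightarrow>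
          (\<forall>x\<in>S m. dist (apply_bcontfun f x) (apply_bcontfun g x) \<le> s) \<Longrightarrow> dist f g \<le> a"
        by blast
      have "dist g h \<le> a" if "g \<in> insert f F" "h \<in> insert f F"
        and close: "\<forall>x\<in>S m. dist (apply_bcontfun g x) (apply_bcontfun h x) \<le> s" for g h
      proof -
        consider "g = f" "h = f" | "g = f" "h \<in> F" | "g \<in> F" "h = f" | "g \<in> F" "h \<in> F"
          using \<open>g \<in> insert f F\<close> \<open>h \<in> insert f F\<close> by blast
        then show ?thesis
        proof cases
          case 1
          then show ?thesis using a b(1) by simp
        next
          case 2
          then show ?thesis using f close by blast
        next
          case 3
          then show ?thesis using f[of g] close by (simp add: dist_commute)
        next
          case 4
          have "S n \<subseteq> S m" using m(1) S by (auto simp: incseq_def)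
          then have "dist g h \<le> (a + b) / 2" using 4 F close m(3) by (meson order_trans subsetD)
          then show ?thesis using a by simp
        qed
      qed
      then show "\<exists>n. \<exists>e>0. \<forall>g\<in>insert f F. \<forall>h\<in>insert f F.
          (\<forall>x\<in>S n. dist (apply_bcontfun g x) (apply_bcontfun h x) \<le> e) \<longrightarrow> dist g h \<le> a"
        using m(2) by blast
    qed
  qed
  ultimately show "Omega S (insert f F) \<le> Omega S F"
    unfolding Omega_def by (intro add_mono)
next
  show "Omega S F \<le> Omega S (insert f F)"
    using assms by (intro Omega_mono) (auto simp: saturating_sequence_def)
qed

section \<open>Vanishing of \<open>Omega\<close> and relative compactness\<close>

text \<open>A finite net in the supremum norm reduces each criterion to finitely many functions:
  their values serve as centres, they are jointly continuous at each point, and finitely many points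
  tell them apart.\<close>

lemma Omega_eq_0_if_compact_closure:
  fixes F :: "('x::metric_space \<Rightarrow>\<^sub>C 'e::banach) set"
  assumes "saturating_sequence S" "compact (closure F)"
  shows "Omega S F = 0"
proof -
  have S: "incseq S" using assms by (simp add: saturating_sequence_def)
  have net: "\<exists>C. finite C \<and> (\<forall>f\<in>F. \<exists>c\<in>C. dist c f < e)" if e: "e > 0" for e
  proof -
    obtain C where C: "finite C" "F \<subseteq> (\<Union>c\<in>C. ball c e)"
      using assms(2) e unfolding compact_closure_iff_finite_nets by blast
    have "\<forall>f\<in>F. \<exists>c\<in>C. dist c f < e" by (auto dest!: subsetD[OF C(2)])
    with C(1) show ?thesis by blast
  qed
  have val: "dist (apply_bcontfun c x) (apply_bcontfun f x) < e" if "dist c f < e"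
    for c f :: "'x \<Rightarrow>\<^sub>C 'e" and x e
    using that dist_bounded[of c x f] by simp
  have "eta F \<le> ennreal 0"
    unfolding eta_le_iff[OF order_refl]
  proof (intro allI impI)
    fix x :: 'x and a :: real assume "a > 0"
    then obtain C where C: "finite C" "\<forall>f\<in>F. \<exists>c\<in>C. dist c f < a" using net by blast
    have "\<forall>f\<in>F. \<exists>v\<in>(\<lambda>c. apply_bcontfun c x) ` C. dist v (apply_bcontfun f x) < a"
      using C(2) val by blast
    then show "\<exists>C. finite C \<and> (\<forall>f\<in>F. \<exists>c\<in>C. dist c (apply_bcontfun f x) < a)"
      using C(1) by blast
  qed
  moreover have "omega0 F \<le> ennreal 0"
    unfolding omega0_le_iff[OF order_refl]
  proof (intro allI impI)
    fix x :: 'x and a :: real assume "a > 0"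
    then have a3: "a / 3 > 0" by simp
    then obtain C where C: "finite C" "\<forall>f\<in>F. \<exists>c\<in>C. dist c f < a / 3" using net by blast
    have "\<forall>\<^sub>F y in nhds x. dist (apply_bcontfun c y) (apply_bcontfun c x) < a / 3" for c :: "'x \<Rightarrow>\<^sub>C 'e"
    proof -
      have "continuous_on UNIV (apply_bcontfun c)" by (rule continuous_on_apply_bcontfun)
      then show ?thesis
        using a3 unfolding continuous_on_iff eventually_nhds_metric by (meson UNIV_I)
    qed
    then have "\<forall>\<^sub>F y in nhds x. \<forall>c\<in>C. dist (apply_bcontfun c y) (apply_bcontfun c x) < a / 3"
      using C(1) by (simp add: eventually_ball_finite)
    then obtain \<delta> where \<delta>: "\<delta> > 0" "\<And>y c. dist y x < \<delta> \<Longrightarrow> c \<in> C \<Longrightarrow>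
        dist (apply_bcontfun c y) (apply_bcontfun c x) < a / 3"
      unfolding eventually_nhds_metric by blast
    have "dist (apply_bcontfun f y) (apply_bcontfun f x) \<le> a" if "f \<in> F" "y \<in> ball x \<delta>" for f y
    proof -
      obtain c where c: "c \<in> C" "dist c f < a / 3" using C(2) \<open>f \<in> F\<close> by blast
      then show ?thesis
        using \<delta>(2)[of y c] that(2) val[OF c(2), of x] val[OF c(2), of y]
          dist_triangle[of "apply_bcontfun f y" "apply_bcontfun f x" "apply_bcontfun c y"]
          dist_triangle[of "apply_bcontfun c y" "apply_bcontfun f x" "apply_bcontfun c x"]
        by (simp add: dist_commute)
    qed
    then show "\<exists>\<delta>>0. \<forall>f\<in>F. \<forall>y\<in>ball x \<delta>. dist (apply_bcontfun f y) (apply_bcontfun f x) \<le> a"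
      using \<delta>(1) by blast
  qed
  moreover have "chi0 S F \<le> ennreal 0"
    unfolding chi0_le_iff[OF S order_refl]
  proof (intro allI impI)
    fix a :: real assume a: "a > 0"
    \<comment> \<open>Passing from \<open>f\<close>, \<open>g\<close> to net members costs
      \<open>2 * e\<close>, and the net members turn out to be within \<open>3 * e\<close>.\<close>
    define e where "e = a / 5"
    have e: "e > 0" using a by (simp add: e_def)
    obtain C where C: "finite C" "\<forall>f\<in>F. \<exists>c\<in>C. dist c f < e" using net[OF e] by blast
    \<comment> \<open>If \<open>c\<close> and \<open>d\<close> are more than \<open>3 * e\<close>
      apart, some point shows it, and that point lies in \<open>S n\<close> for all large
      \<open>n\<close>, making the premise false. As \<open>C\<close> is finite, one
      \<open>n\<close> then serves all pairs.\<close>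
    have separated: "\<forall>\<^sub>F n in sequentially. (\<forall>x\<in>S n.
        dist (apply_bcontfun c x) (apply_bcontfun d x) \<le> 3 * e) \<longrightarrow> dist c d \<le> 3 * e"
      for c d :: "'x \<Rightarrow>\<^sub>C 'e"
    proof (cases "dist c d \<le> 3 * e")
      case False
      then obtain x where x: "dist (apply_bcontfun c x) (apply_bcontfun d x) > 3 * e"
        using dist_bound[of c d "3 * e"] by (meson not_le)
      obtain m where "x \<in> S m" using saturating_sequence_point[OF assms(1)] by blast
      then have "x \<in> S n" if "n \<ge> m" for n using that S by (auto simp: incseq_def)
      then show ?thesis using x unfolding eventually_sequentially by (meson not_le)
    qed simp
    have "\<forall>\<^sub>F n in sequentially. \<forall>c\<in>C. \<forall>d\<in>C. (\<forall>x\<in>S n.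
        dist (apply_bcontfun c x) (apply_bcontfun d x) \<le> 3 * e) \<longrightarrow> dist c d \<le> 3 * e"
      using C(1) separated by (intro eventually_ball_finite ballI) auto
    then obtain n where n: "\<And>c d. c \<in> C \<Longrightarrow> d \<in> C \<Longrightarrow> (\<forall>x\<in>S n.
        dist (apply_bcontfun c x) (apply_bcontfun d x) \<le> 3 * e) \<Longrightarrow> dist c d \<le> 3 * e"
      unfolding eventually_sequentially by blast
    have "dist f g \<le> a" if "f \<in> F" "g \<in> F"
      and fg: "\<forall>x\<in>S n. dist (apply_bcontfun f x) (apply_bcontfun g x) \<le> e" for f g
    proof -
      obtain c d where c: "c \<in> C" "dist c f < e" and d: "d \<in> C" "dist d g < e"
        using C(2) \<open>f \<in> F\<close> \<open>g \<in> F\<close> by blast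
      have "dist (apply_bcontfun c x) (apply_bcontfun d x) \<le> 3 * e" if "x \<in> S n" for x
        using bspec[OF fg that] val[OF c(2), of x] val[OF d(2), of x]
          dist_triangle[of "apply_bcontfun c x" "apply_bcontfun d x" "apply_bcontfun f x"]
          dist_triangle[of "apply_bcontfun f x" "apply_bcontfun d x" "apply_bcontfun g x"]
        by (simp add: dist_commute)
      then have "dist c d \<le> 3 * e" using n c(1) d(1) by blast
      then show ?thesis
        using c(2) d(2) dist_triangle[of f g c] dist_triangle[of c g d]
        by (simp add: dist_commute e_def)
    qed
    then show "\<exists>n. \<exists>e>0. \<forall>f\<in>F. \<forall>g\<in>F.
        (\<forall>x\<in>S n. dist (apply_bcontfun f x) (apply_bcontfun g x) \<le> e) \<longrightarrow> dist f g \<le> a"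
      using e by blast
  qed
  ultimately show ?thesis by (simp add: Omega_def)
qed

text \<open>The Arzela-Ascoli step. Finitely many balls of small oscillation cover \<open>K\<close>,
  and each function is encoded by net values near its values at the ball centres. There are finitely
  many codes, and functions with equal codes differ by at most \<open>e\<close> on \<open>K\<close>:
  two oscillations and two net errors, each up to \<open>e / 4\<close>.\<close>

lemma finite_net_on_compact:
  fixes F :: "('x::metric_space \<Rightarrow>\<^sub>C 'e::real_normed_vector) set"
  assumes "eta F = 0" "omega0 F = 0" "compact K" "e > 0"
  obtains C where "finite C" "C \<subseteq> F"
    "\<And>f. f \<in> F \<Longrightarrow> \<exists>c\<in>C. \<forall>x\<in>K. dist (apply_bcontfun f x) (apply_bcontfun c x) \<le> e"
proof -
  have e4: "e / 4 > 0" using assms(4) by simp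
  have "omega0 F \<le> ennreal 0" using assms(2) by simp
  then have "\<forall>x. \<exists>\<delta>>0. \<forall>f\<in>F. \<forall>y\<in>ball x \<delta>.
      dist (apply_bcontfun f y) (apply_bcontfun f x) \<le> e / 4"
    using e4 unfolding omega0_le_iff[OF order_refl] by blast
  then obtain \<delta> where \<delta>: "\<And>x. \<delta> x > 0" "\<And>x f y. f \<in> F \<Longrightarrow> y \<in> ball x (\<delta> x) \<Longrightarrow>
      dist (apply_bcontfun f y) (apply_bcontfun f x) \<le> e / 4"
    by metis
  obtain P where P: "P \<subseteq> K" "finite P" "K \<subseteq> (\<Union>p\<in>P. ball p (\<delta> p))"
    by (rule compactE_image[OF assms(3), of K "\<lambda>p. ball p (\<delta> p)"]) (use \<delta>(1) in auto)
  have "eta F \<le> ennreal 0" using assms(1) by simp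
  then have "\<forall>x. \<exists>C. finite C \<and> (\<forall>f\<in>F. \<exists>c\<in>C. dist c (apply_bcontfun f x) < e / 4)"
    using e4 unfolding eta_le_iff[OF order_refl] by blast
  then obtain N where N: "\<And>x. finite (N x)"
      "\<And>x f. f \<in> F \<Longrightarrow> \<exists>c\<in>N x. dist c (apply_bcontfun f x) < e / 4"
    by metis
  then obtain h where h: "\<And>f x. f \<in> F \<Longrightarrow> h f x \<in> N x"
      "\<And>f x. f \<in> F \<Longrightarrow> dist (h f x) (apply_bcontfun f x) < e / 4"
    by metis
  \<comment> \<open>The code of \<open>f\<close>. Restriction to \<open>P\<close> puts it into the
    finite product \<open>PiE P N\<close>.\<close>
  define r where "r f = restrict (h f) P" for f
  have "r ` F \<subseteq> PiE P N" using h(1) by (auto simp: r_def)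
  then have "finite (r ` F)" using P(2) N(1) by (meson finite_PiE finite_subset)
  \<comment> \<open>One representative per code, taken from \<open>F\<close> itself: the criterion
    for \<open>chi0\<close> compares members of the family only.\<close>
  moreover have "inv_into F r ` r ` F \<subseteq> F" by (auto intro: inv_into_into)
  moreover have "\<exists>c\<in>inv_into F r ` r ` F. \<forall>x\<in>K. dist (apply_bcontfun f x) (apply_bcontfun c x) \<le> e"
    if f: "f \<in> F" for f
  proof (intro bexI ballI)
    define c where "c = inv_into F r (r f)"
    have c: "c \<in> F" "r c = r f" unfolding c_def using f by (auto intro: inv_into_into f_inv_into_f)
    show "c \<in> inv_into F r ` r ` F" using f by (simp add: c_def)
    fix x assume "x \<in> K"
    then obtain p where p: "p \<in> P" "x \<in> ball p (\<delta> p)" using P(3) by blast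
    have "h c p = h f p" using c(2) p(1) unfolding r_def by (metis restrict_apply')
    then have "dist (apply_bcontfun f p) (apply_bcontfun c p) < e / 2"
      using h(2)[OF f, of p] h(2)[OF c(1), of p]
        dist_triangle[of "apply_bcontfun f p" "apply_bcontfun c p" "h f p"]
      by (simp add: dist_commute)
    then show "dist (apply_bcontfun f x) (apply_bcontfun c x) \<le> e"
      using \<delta>(2)[OF f p(2)] \<delta>(2)[OF c(1) p(2)]
        dist_triangle[of "apply_bcontfun f x" "apply_bcontfun c x" "apply_bcontfun f p"]
        dist_triangle[of "apply_bcontfun f p" "apply_bcontfun c x" "apply_bcontfun c p"]
      by (simp add: dist_commute)
  qed
  ultimately show thesis using that[of "inv_into F r ` r ` F"] by blast
qed

text \<open>First \<open>chi0\<close> fixes \<open>n\<close> and \<open>e\<close>, then the net on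
  the compact set \<open>S n\<close> is taken with precision \<open>e\<close>. Its centres lie in
  \<open>F\<close>, so closeness on \<open>S n\<close> becomes uniform closeness.\<close>

lemma compact_closure_if_Omega_eq_0:
  fixes F :: "('x::metric_space \<Rightarrow>\<^sub>C 'e::banach) set"
  assumes "saturating_sequence S" "Omega S F = 0"
  shows "compact (closure F)"
  unfolding compact_closure_iff_finite_nets
proof (intro allI impI)
  fix a :: real assume a: "a > 0"
  have S: "incseq S" "\<And>n. compact (S n)" using assms(1) by (auto simp: saturating_sequence_def)
  have zero: "eta F = 0" "omega0 F = 0" "chi0 S F \<le> ennreal 0"
    using assms(2) by (simp_all add: Omega_def)
  have "a / 2 > 0" using a by simp
  then obtain n e where e: "e > 0" and F: "\<And>f g. f \<in> F \<Longrightarrow> g \<in> F \<Longrightarrow>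
      (\<forall>x\<in>S n. dist (apply_bcontfun f x) (apply_bcontfun g x) \<le> e) \<Longrightarrow> dist f g \<le> a / 2"
    using zero(3) unfolding chi0_le_iff[OF S(1) order_refl] by blast
  obtain C where C: "finite C" "C \<subseteq> F"
    "\<And>f. f \<in> F \<Longrightarrow> \<exists>c\<in>C. \<forall>x\<in>S n. dist (apply_bcontfun f x) (apply_bcontfun c x) \<le> e"
    using finite_net_on_compact[OF zero(1,2) S(2)[of n] e] by blast
  have "F \<subseteq> (\<Union>c\<in>C. ball c a)"
  proof
    fix f assume f: "f \<in> F"
    then obtain c where c: "c \<in> C"
      "\<forall>x\<in>S n. dist (apply_bcontfun f x) (apply_bcontfun c x) \<le> e"
      using C(3) by blast
    then have "dist f c \<le> a / 2" using F f C(2) by blast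
    then have "dist c f < a" using a by (simp add: dist_commute)
    then show "f \<in> (\<Union>c\<in>C. ball c a)" using c(1) by auto
  qed
  then show "\<exists>C. finite C \<and> F \<subseteq> (\<Union>c\<in>C. ball c a)" using C(1) by blast
qed

section \<open>Homogeneity\<close>

text \<open>Version of \<open>ennreal_le_by_real_bounds\<close> with a factor. Positivity of
  \<open>k\<close> makes the right-hand side infinite when \<open>y\<close> is.\<close>

lemma ennreal_le_mult_by_real_bounds:
  assumes "k > 0" "\<And>b. b \<ge> 0 \<Longrightarrow> y \<le> ennreal b \<Longrightarrow> x \<le> ennreal (k * b)"
  shows "x \<le> ennreal k * y"
proof (cases y)
  case (real b)
  then show ?thesis using assms by (simp add: ennreal_mult)
next
  case top
  then show ?thesis using assms(1) by (simp add: ennreal_mult_top)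
qed

context normed_scalars
begin

lemma dist_scaleK: "dist (scaleK c v) (scaleK c w) = norm c * dist v w"
  by (simp add: dist_norm norm_scaleK flip: scale_right_diff_distrib)

text \<open>A threshold \<open>a\<close> for the scaled family is the threshold
  \<open>a / norm c\<close> for \<open>F\<close>; net centres and the tolerance on
  \<open>S n\<close> are scaled along, while the radius in the domain is kept.\<close>

lemma Omega_scaleK_le:
  fixes F :: "('x::metric_space \<Rightarrow>\<^sub>C 'e) set"
  assumes S: "incseq S" and "c \<noteq> 0"
  shows "Omega S (bcontfun_scaleK scaleK c ` F) \<le> ennreal (norm c) * Omega S F"
proof -
  let ?s = "bcontfun_scaleK scaleK c :: ('x \<Rightarrow>\<^sub>C 'e) \<Rightarrow> _"
  have c: "norm c > 0" using assms(2) by simp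
  \<comment> \<open>Provides \<open>bc.dist_scaleK\<close>, the scaling of the uniform distance,
    next to the pointwise \<open>dist_scaleK\<close>.\<close>
  interpret bc: normed_scalars "bcontfun_scaleK scaleK :: 'k \<Rightarrow> ('x \<Rightarrow>\<^sub>C 'e) \<Rightarrow> _"
    by (rule normed_scalars_bcontfun)
  have *: "a / norm c > b" if "a > norm c * b" for a b
    using that c by (simp add: field_simps)
  have "eta (?s ` F) \<le> ennreal (norm c) * eta F"
  proof (rule ennreal_le_mult_by_real_bounds[OF c])
    fix b :: real assume b: "b \<ge> 0" "eta F \<le> ennreal b"
    have cb: "norm c * b \<ge> 0" using b(1) by simp
    show "eta (?s ` F) \<le> ennreal (norm c * b)"
      unfolding eta_le_iff[OF cb]
    proof (intro allI impI)
      fix x a assume "a > norm c * b"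
      then have "a / norm c > b" by (rule *)
      then obtain C where C: "finite C" "\<forall>f\<in>F. \<exists>v\<in>C. dist v (apply_bcontfun f x) < a / norm c"
        using b(2) unfolding eta_le_iff[OF b(1)] by blast
      have "\<forall>f\<in>?s ` F. \<exists>v\<in>scaleK c ` C. dist v (apply_bcontfun f x) < a"
        using C(2) c by (simp add: dist_scaleK field_simps)
      then show "\<exists>C. finite C \<and> (\<forall>f\<in>?s ` F. \<exists>v\<in>C. dist v (apply_bcontfun f x) < a)"
        using C(1) by blast
    qed
  qed
  moreover have "omega0 (?s ` F) \<le> ennreal (norm c) * omega0 F"
  proof (rule ennreal_le_mult_by_real_bounds[OF c])
    fix b :: real assume b: "b \<ge> 0" "omega0 F \<le> ennreal b"
    have cb: "norm c * b \<ge> 0" using b(1) by simp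
    show "omega0 (?s ` F) \<le> ennreal (norm c * b)"
      unfolding omega0_le_iff[OF cb]
    proof (intro allI impI)
      fix x a assume "a > norm c * b"
      then have "a / norm c > b" by (rule *)
      then obtain \<delta> where \<delta>: "\<delta> > 0" "\<forall>f\<in>F. \<forall>y\<in>ball x \<delta>.
          dist (apply_bcontfun f y) (apply_bcontfun f x) \<le> a / norm c"
        using b(2) unfolding omega0_le_iff[OF b(1)] by blast
      have "\<forall>f\<in>?s ` F. \<forall>y\<in>ball x \<delta>. dist (apply_bcontfun f y) (apply_bcontfun f x) \<le> a"
        using \<delta>(2) c by (simp add: dist_scaleK field_simps)
      then show "\<exists>\<delta>>0. \<forall>f\<in>?s ` F. \<forall>y\<in>ball x \<delta>.
          dist (apply_bcontfun f y) (apply_bcontfun f x) \<le> a"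
        using \<delta>(1) by blast
    qed
  qed
  moreover have "chi0 S (?s ` F) \<le> ennreal (norm c) * chi0 S F"
  proof (rule ennreal_le_mult_by_real_bounds[OF c])
    fix b :: real assume b: "b \<ge> 0" "chi0 S F \<le> ennreal b"
    have cb: "norm c * b \<ge> 0" using b(1) by simp
    show "chi0 S (?s ` F) \<le> ennreal (norm c * b)"
      unfolding chi0_le_iff[OF S cb]
    proof (intro allI impI)
      fix a assume "a > norm c * b"
      then have "a / norm c > b" by (rule *)
      then obtain n e where e: "e > 0" "\<forall>f\<in>F. \<forall>g\<in>F.
          (\<forall>x\<in>S n. dist (apply_bcontfun f x) (apply_bcontfun g x) \<le> e) \<longrightarrow> dist f g \<le> a / norm c"
        using b(2) unfolding chi0_le_iff[OF S b(1)] by blast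
      have "\<forall>f\<in>?s ` F. \<forall>g\<in>?s ` F.
          (\<forall>x\<in>S n. dist (apply_bcontfun f x) (apply_bcontfun g x) \<le> norm c * e) \<longrightarrow> dist f g \<le> a"
        using e(2) c by (simp add: dist_scaleK bc.dist_scaleK field_simps)
      with mult_pos_pos[OF c e(1)] show "\<exists>n. \<exists>e>0. \<forall>f\<in>?s ` F. \<forall>g\<in>?s ` F.
          (\<forall>x\<in>S n. dist (apply_bcontfun f x) (apply_bcontfun g x) \<le> e) \<longrightarrow> dist f g \<le> a"
        by (intro exI conjI)
    qed
  qed
  ultimately show ?thesis
    unfolding Omega_def distrib_left by (intro add_mono)
qed

text \<open>The reverse inequality is the same estimate for \<open>inverse c\<close> and the scaled
  family, multiplied by \<open>norm c\<close>.\<close>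

lemma Omega_scaleK:
  fixes F :: "('x::metric_space \<Rightarrow>\<^sub>C 'e) set"
  assumes "incseq S" "c \<noteq> 0"
  shows "Omega S (bcontfun_scaleK scaleK c ` F) = ennreal (norm c) * Omega S F"
proof (rule antisym)
  let ?s = "bcontfun_scaleK scaleK :: 'k \<Rightarrow> ('x \<Rightarrow>\<^sub>C 'e) \<Rightarrow> _"
  have "?s (inverse c) (?s c f) = f" for f
    using assms(2) by (intro bcontfun_eqI) simp
  then have F: "?s (inverse c) ` ?s c ` F = F" by (simp add: image_image)
  have "Omega S F \<le> ennreal (norm (inverse c)) * Omega S (?s c ` F)"
    using Omega_scaleK_le[OF assms(1), of "inverse c" "?s c ` F"] assms(2) unfolding F by simp
  then have "ennreal (norm c) * Omega S F \<le>
      ennreal (norm c) * (ennreal (norm (inverse c)) * Omega S (?s c ` F))"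
    by (rule mult_left_mono) simp
  also have "\<dots> = Omega S (?s c ` F)"
    using assms(2) by (simp add: norm_inverse flip: mult.assoc ennreal_mult)
  finally show "ennreal (norm c) * Omega S F \<le> Omega S (?s c ` F)" .
qed (rule Omega_scaleK_le[OF assms])

end

section \<open>The quasimeasure axioms and convex hulls\<close>

theorem theorem5:
  fixes S :: "nat \<Rightarrow> 'x::euclidean_space set"
    and scaleK :: "'k::real_normed_field \<Rightarrow> 'e::banach \<Rightarrow> 'e"
  assumes "normed_scalars scaleK"
    and "saturating_sequence S"
  shows "quasimeasure_of_noncompactness (bcontfun_scaleK scaleK)
      (Omega S :: ('x \<Rightarrow>\<^sub>C 'e) set \<Rightarrow> ennreal)
    \<and> (\<forall>F :: ('x \<Rightarrow>\<^sub>C 'e) set. bounded F \<longrightarrow> Omega S F = 0 \<longrightarrow> Omega S (convex hull F) = 0)"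
proof -
  interpret normed_scalars scaleK by fact
  interpret bc: normed_scalars "bcontfun_scaleK scaleK :: 'k \<Rightarrow> ('x \<Rightarrow>\<^sub>C 'e) \<Rightarrow> _"
    by (rule normed_scalars_bcontfun)
  have S: "incseq S" using assms(2) by (simp add: saturating_sequence_def)
  have zero_iff: "Omega S F = 0 \<longleftrightarrow> compact (closure F)" for F :: "('x \<Rightarrow>\<^sub>C 'e) set"
    using Omega_eq_0_if_compact_closure[OF assms(2)] compact_closure_if_Omega_eq_0[OF assms(2)]
    by blast
  have "quasimeasure_of_noncompactness (bcontfun_scaleK scaleK)
      (Omega S :: ('x \<Rightarrow>\<^sub>C 'e) set \<Rightarrow> ennreal)"
  proof unfold_locales
    fix A B :: "('x \<Rightarrow>\<^sub>C 'e) set" and c :: 'k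
    show "Omega S A < \<infinity>" if "bounded A" using Omega_finite[OF S that] .
    show "Omega S A = 0 \<longleftrightarrow> compact (closure A)" by (rule zero_iff)
    show "Omega S A \<le> Omega S B" if "A \<subseteq> B" using Omega_mono[OF S that] .
    show "Omega S (closure A) = Omega S A" using Omega_closure[OF S] .
    show "Omega S (bcontfun_scaleK scaleK c ` A) = ennreal (norm c) * Omega S A"
    \<comment> \<open>\<open>Omega_scaleK\<close> divides by \<open>c\<close>, so zero is treated
      apart: the image lies in \<open>{0}\<close> and has value 0 by \<open>zero_iff\<close>, as has
      the product on the right.\<close>
    proof (cases "c = 0")
      case True
      have "bcontfun_scaleK scaleK c ` A \<subseteq> {0}" using True by auto
      then have "finite (bcontfun_scaleK scaleK c ` A)" using finite_subset by blast
      then have "compact (closure (bcontfun_scaleK scaleK c ` A))"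
        by (simp add: finite_imp_closed finite_imp_compact)
      then show ?thesis using True by (simp add: zero_iff)
    qed (rule Omega_scaleK[OF S])
    \<comment> \<open>QMN5: the finite set is added one function at a time.\<close>
    show "Omega S (A \<union> B) = Omega S B" if "finite A"
      using that by induction (simp_all add: Omega_insert[OF assms(2)])
  qed
  \<comment> \<open>Through \<open>zero_iff\<close>, the claim on convex hulls is Mazur's theorem in
    the space of bounded continuous functions.\<close>
  then show ?thesis using zero_iff compact_closure_convex_hull by blast
qed

end
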